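(* Let $\alpha'>0$ and consider the linearized system for real fluctuations $T,\tilde C$ on $\mathbb{R}^{1,7}\times B$, where $B$ is a compact base with local complex coordinate $z$ and metric $e^{\rho(z,\bar z)}dz\,d\bar z$ of finite area, in a background $\tau=\tau_1+\mathsf{i}\tau_2$: $$\Box_8T+4e^{-\rho}\partial_z\partial_{\bar z}T-m_{\mathrm{eff}}^2\tau_2^{-1/2}T=\frac{1}{2\sqrt2}e^{-\rho}\tau_2^{-2}\left(\partial_z\tau\,\partial_{\bar z}\tilde C+\partial_{\bar z}\bar\tau\,\partial_z\tilde C\right),\qquad m_{\mathrm{eff}}^2=-\frac{2}{\alpha'}+\frac{|\partial_z\tau|^2}{4\tau_2^{3/2}e^{\rho}},$$ $$\Box_8\tilde C+2e^{-\rho}\tau_2^2\left(\partial_z(\tau_2^{-2}\partial_{\bar z}\tilde C)+\partial_{\bar z}(\tau_2^{-2}\partial_z\tilde C)\right)=-\frac{1}{2\sqrt2}e^{-\rho}\left(\partial_z\tau\,\partial_{\bar z}T+\partial_{\bar z}\bar\tau\,\partial_zT\right).$$ In the constant background $\tau\equiv\frac{1+\mathsf{i}}{2}$ this system reduces to the decoupled equations $$\left(\Box_8+4e^{-\rho}\partial_z\partial_{\bar z}+\frac{2}{\alpha'}\tau_2^{-1/2}\right)T=0,\qquad \left(\Box_8+4e^{-\rho}\partial_z\partial_{\bar z}\right)\tilde C=0,\qquad \tau_2=\tfrac12,$$ and the lowest Kaluza–Klein mode of $T$ on $B$ is the constant mode, whose eight-dimensional mass squared is $-\frac{2}{\alpha'\sqrt{\tau_2}}<0$,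 independently of the overall size of $B$.
   Context: $\Box_8$ is the d'Alembertian of flat $(1+7)$-dimensional Minkowski space $\mathbb{R}^{1,7}$ (mostly plus signature, so a field of mass squared $M^2$ satisfies $(\Box_8-M^2)\phi=0$). In the application $B=\mathbb{CP}^1$ is the base of the fibration $y^2=x^3+b(z)x$ with $b$ of degree eight having distinct roots, whose metric is smooth except for conical singularities at the roots of $b$. Kaluza–Klein modes of $T$ are functions $\psi$ on $B$ such that $T(x,z)=\phi(x)\psi(z)$ solves the equation with $(\Box_8-M^2)\phi=0$; the eight-dimensional mass squared $M^2$ is the corresponding eigenvalue of $-4e^{-\rho}\partial_z\partial_{\bar z}-\frac{2}{\alpha'}\tau_2^{-1/2}$. The operator $-4e^{-\rho}\partial_z\partial_{\bar z}$ is understood through its quadratic form $\int_B4|\partial_z\psi|^2\,d^2x$ relative to the norm $\int_B e^{\rho}|\psi|^2\,d^2x$ (with $z=x^8+\mathsf{i}x^9$, $d^2x=dx^8dx^9$). *)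

theory Defs
  imports "HOL-Analysis.Analysis"
begin

section \<open>Differentiability classes and Wirtinger derivatives\<close>

text \<open>\<open>Ck_on k S f\<close> is the usual class \<open>C\<^sup>k(S)\<close> when \<open>S\<close> is open and the domain is
  finite-dimensional.\<close>

primrec Ck_on :: "nat \<Rightarrow> 'a::real_normed_vector set \<Rightarrow> ('a \<Rightarrow> 'b::real_normed_vector) \<Rightarrow> bool" where
  "Ck_on 0 S f \<longleftrightarrow> continuous_on S f"
| "Ck_on (Suc k) S f \<longleftrightarrow> (\<forall>x\<in>S. f differentiable (at x)) \<and>
     (\<forall>v. Ck_on k S (\<lambda>x. frechet_derivative f (at x) v))"

definition d_z :: "(complex \<Rightarrow> complex) \<Rightarrow> complex \<Rightarrow> complex" where
  "d_z f w = (frechet_derivative f (at w) 1 - \<i> * frechet_derivative f (at w) \<i>) / 2"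

definition d_zbar :: "(complex \<Rightarrow> complex) \<Rightarrow> complex \<Rightarrow> complex" where
  "d_zbar f w = (frechet_derivative f (at w) 1 + \<i> * frechet_derivative f (at w) \<i>) / 2"

text \<open>The coordinates of \<open>real ^ 8\<close> are indexed by \<open>0, \<dots>, 7\<close>; the coordinate \<open>0\<close> is time and
  the signature is mostly plus.\<close>

definition minkowski_sign :: "8 \<Rightarrow> real" where
  "minkowski_sign i = (if i = 0 then -1 else 1)"

definition dalembertian :: "(real ^ 8 \<Rightarrow> real) \<Rightarrow> real ^ 8 \<Rightarrow> real" where
  "dalembertian f x = (\<Sum>i\<in>UNIV. minkowski_sign i *
     frechet_derivative (\<lambda>y. frechet_derivative f (at y) (axis i 1)) (at x) (axis i 1))"

section \<open>The base\<close>

text \<open>A chart is a pair of a coordinate domain and a local complex coordinate.\<close>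

type_synonym 'b chart = "'b set \<times> ('b \<Rightarrow> complex)"

definition chart_inv :: "'b chart \<Rightarrow> complex \<Rightarrow> 'b" where
  "chart_inv c = inv_into (fst c) (snd c)"

definition is_chart :: "'b::topological_space chart \<Rightarrow> bool" where
  "is_chart c \<longleftrightarrow> open (fst c) \<and> open (snd c ` fst c) \<and>
     homeomorphism (fst c) (snd c ` fst c) (snd c) (chart_inv c)"

definition holomorphic_atlas :: "'b::topological_space chart set \<Rightarrow> bool" where
  "holomorphic_atlas \<A> \<longleftrightarrow> (\<forall>c\<in>\<A>. is_chart c) \<and> (\<Union>c\<in>\<A>. fst c) = UNIV \<and>
     (\<forall>c\<in>\<A>. \<forall>c'\<in>\<A>. (snd c' \<circ> chart_inv c) holomorphic_on (snd c ` (fst c \<inter> fst c')))"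

text \<open>A density \<open>d\<close> assigns to each chart \<open>c\<close> a function \<open>d c\<close> of the coordinate \<open>w\<close>, standing
  for \<open>d c w d\<^sup>2w\<close>. It is integrated by cutting the base into finitely many measurable pieces, each
  inside one chart. For densities that transform with \<open>\<bar>dw'/dw\<bar>\<^sup>2\<close> (all those used below) the
  result does not depend on the pieces, by the change of variables formula.\<close>

definition chart_dissection :: "'b chart set \<Rightarrow> ('b chart \<times> 'b set) set \<Rightarrow> bool" where
  "chart_dissection \<A> D \<longleftrightarrow> finite D \<and>
     (\<forall>(c, A)\<in>D. c \<in> \<A> \<and> A \<subseteq> fst c \<and> snd c ` A \<in> sets borel) \<and>
     (\<forall>P\<in>D. \<forall>Q\<in>D. P \<noteq> Q \<longrightarrow> snd P \<inter> snd Q = {}) \<and> (\<Union>P\<in>D. snd P) = UNIV"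

lemma chart_dissection_exists:
  fixes \<A> :: "'b::topological_space chart set"
  assumes A: "holomorphic_atlas \<A>" and K: "compact (UNIV :: 'b set)"
  shows "\<exists>D. chart_dissection \<A> D"
proof -
  have op: "open (snd c ` V)" if "c \<in> \<A>" "open V" "V \<subseteq> fst c" for c V
  proof -
    have h: "homeomorphism (fst c) (snd c ` fst c) (snd c) (chart_inv c)"
      and o: "open (snd c ` fst c)"
      using A that(1) by (auto simp: holomorphic_atlas_def is_chart_def)
    have "openin (top_of_set (fst c)) V"
      using that by (metis inf.absorb_iff2 openin_open)
    from homeomorphism_imp_open_map[OF h this] o show ?thesis
      using openin_open_trans by blast
  qed
  have ofst: "open (fst c)" if "c \<in> \<A>" for c
    using A that by (auto simp: holomorphic_atlas_def is_chart_def)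
  have "\<exists>C\<subseteq>\<A>. finite C \<and> UNIV \<subseteq> (\<Union>c\<in>C. fst c)"
    using compactE_image[OF K, of \<A> fst] ofst A
    by (metis holomorphic_atlas_def order_refl)
  then obtain C where C: "C \<subseteq> \<A>" "finite C" "(\<Union>c\<in>C. fst c) = UNIV" by blast
  have "\<exists>D. finite D \<and> (\<forall>(c, A)\<in>D. c \<in> \<A> \<and> A \<subseteq> fst c \<and> snd c ` A \<in> sets borel) \<and>
     (\<forall>P\<in>D. \<forall>Q\<in>D. P \<noteq> Q \<longrightarrow> snd P \<inter> snd Q = {}) \<and> (\<Union>P\<in>D. snd P) = (\<Union>c\<in>C. fst c)"
    using C(2,1)
  proof (induction C)
    case empty
    then show ?case by (intro exI[of _ "{}"]) auto
  next
    case (insert c C)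
    then obtain D where D: "finite D" 
      "\<forall>(c, A)\<in>D. c \<in> \<A> \<and> A \<subseteq> fst c \<and> snd c ` A \<in> sets borel"
      "\<forall>P\<in>D. \<forall>Q\<in>D. P \<noteq> Q \<longrightarrow> snd P \<inter> snd Q = {}" "(\<Union>P\<in>D. snd P) = (\<Union>c\<in>C. fst c)"
      by auto
    define U where "U = (\<Union>c\<in>C. fst c)"
    have cA: "c \<in> \<A>" using insert.prems by auto
    have oU: "open U" unfolding U_def using insert.prems ofst by (intro open_UN) blast
    have inj: "inj_on (snd c) (fst c)"
      using A cA unfolding holomorphic_atlas_def is_chart_def homeomorphism_def
      by (metis inj_on_inverseI)
    have "snd c ` (fst c - U) = snd c ` fst c - snd c ` (fst c \<inter> U)"
      using inj by (auto simp: inj_on_def)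
    moreover have "open (snd c ` fst c)" "open (snd c ` (fst c \<inter> U))"
      using op[OF cA] ofst[OF cA] oU by auto
    ultimately have b: "snd c ` (fst c - U) \<in> sets borel" by auto
    show ?case
      by (rule exI[of _ "insert (c, fst c - U) D"])
        (use D b cA in \<open>auto simp: U_def[symmetric]\<close>)
  qed
  then show ?thesis using C(3) by (auto simp: chart_dissection_def)
qed

definition pieces :: "'b chart set \<Rightarrow> ('b chart \<times> 'b set) set" where
  "pieces \<A> = (SOME D. chart_dissection \<A> D)"

definition surface_integrable :: "'b chart set \<Rightarrow> ('b chart \<Rightarrow> complex \<Rightarrow> real) \<Rightarrow> bool" where
  "surface_integrable \<A> d \<longleftrightarrow> (\<forall>(c, A)\<in>pieces \<A>. set_integrable lborel (snd c ` A) (d c))"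

definition surface_integral :: "'b chart set \<Rightarrow> ('b chart \<Rightarrow> complex \<Rightarrow> real) \<Rightarrow> real" where
  "surface_integral \<A> d = (\<Sum>(c, A)\<in>pieces \<A>. LINT w:snd c ` A|lborel. d c w)"

text \<open>The part of the coordinate range of \<open>c\<close> where the metric is smooth.\<close>

definition regular_range :: "'b set \<Rightarrow> 'b chart \<Rightarrow> complex set" where
  "regular_range S c = snd c ` (fst c - S)"

text \<open>A compact connected Riemann surface (the whole type \<open>'b\<close>) whose metric is \<open>exp (\<rho> c) dw dw'\<close>,
  \<open>w'\<close> the conjugate of \<open>w\<close>, in the chart \<open>c\<close>. It is smooth off the finite set \<open>S\<close>, where it may
  have conical or other singularities, and has finite area.\<close>

definition compact_base ::
  "'b::t2_space chart set \<Rightarrow> 'b set \<Rightarrow> ('b chart \<Rightarrow> complex \<Rightarrow> real) \<Rightarrow> bool" where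
  "compact_base \<A> S \<rho> \<longleftrightarrow>
     compact (UNIV :: 'b set) \<and> connected (UNIV :: 'b set) \<and> holomorphic_atlas \<A> \<and> finite S \<and>
     (\<forall>c\<in>\<A>. \<forall>k. Ck_on k (regular_range S c) (\<rho> c)) \<and>
     (\<forall>c\<in>\<A>. \<forall>c'\<in>\<A>. \<forall>p\<in>fst c \<inter> fst c' - S.
        exp (\<rho> c (snd c p)) =
        exp (\<rho> c' (snd c' p)) * (cmod (deriv (snd c' \<circ> chart_inv c) (snd c p)))\<^sup>2) \<and>
     surface_integrable \<A> (\<lambda>c w. exp (\<rho> c w))"

section \<open>The linearized system\<close>

text \<open>Fluctuations are real fields of class \<open>C\<^sup>2\<close> on \<open>\<real>\<^sup>1\<^sup>,\<^sup>7 \<times> (B - S)\<close>.\<close>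

definition fluctuation ::
  "'b chart set \<Rightarrow> 'b set \<Rightarrow> (real ^ 8 \<Rightarrow> 'b \<Rightarrow> real) \<Rightarrow> bool" where
  "fluctuation \<A> S T \<longleftrightarrow>
     (\<forall>c\<in>\<A>. Ck_on 2 (UNIV \<times> regular_range S c) (\<lambda>(x, w). T x (chart_inv c w)))"

text \<open>Coordinate expression of a function on the base. Real fields are complexified, since the
  Wirtinger operators act on complex functions.\<close>

definition loc :: "'b chart \<Rightarrow> ('b \<Rightarrow> complex) \<Rightarrow> complex \<Rightarrow> complex" where
  "loc c f w = f (chart_inv c w)"

definition rloc :: "'b chart \<Rightarrow> ('b \<Rightarrow> real) \<Rightarrow> complex \<Rightarrow> complex" where
  "rloc c f w = complex_of_real (f (chart_inv c w))"

definition tau2 :: "'b chart \<Rightarrow> ('b \<Rightarrow> complex) \<Rightarrow> complex \<Rightarrow> real" where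
  "tau2 c \<tau> w = Im (\<tau> (chart_inv c w))"

definition m_eff_sq ::
  "real \<Rightarrow> ('b chart \<Rightarrow> complex \<Rightarrow> real) \<Rightarrow> ('b \<Rightarrow> complex) \<Rightarrow> 'b chart \<Rightarrow> complex \<Rightarrow> real" where
  "m_eff_sq \<alpha> \<rho> \<tau> c w =
     - 2 / \<alpha> + (cmod (d_z (loc c \<tau>) w))\<^sup>2 / (4 * tau2 c \<tau> w powr (3/2) * exp (\<rho> c w))"

definition T_equation_at ::
  "real \<Rightarrow> ('b chart \<Rightarrow> complex \<Rightarrow> real) \<Rightarrow> ('b \<Rightarrow> complex) \<Rightarrow> (real ^ 8 \<Rightarrow> 'b \<Rightarrow> real) \<Rightarrow>
   (real ^ 8 \<Rightarrow> 'b \<Rightarrow> real) \<Rightarrow> 'b chart \<Rightarrow> real ^ 8 \<Rightarrow> complex \<Rightarrow> bool" where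
  "T_equation_at \<alpha> \<rho> \<tau> T C c x w \<longleftrightarrow>
     of_real (dalembertian (\<lambda>y. T y (chart_inv c w)) x)
     + 4 * of_real (exp (- \<rho> c w)) * d_z (d_zbar (rloc c (T x))) w
     - of_real (m_eff_sq \<alpha> \<rho> \<tau> c w * tau2 c \<tau> w powr (-1/2)) * rloc c (T x) w
     = of_real (1 / (2 * sqrt 2) * exp (- \<rho> c w) * (1 / (tau2 c \<tau> w)\<^sup>2)) *
       (d_z (loc c \<tau>) w * d_zbar (rloc c (C x)) w
        + d_zbar (loc c (\<lambda>p. cnj (\<tau> p))) w * d_z (rloc c (C x)) w)"

definition C_equation_at ::
  "('b chart \<Rightarrow> complex \<Rightarrow> real) \<Rightarrow> ('b \<Rightarrow> complex) \<Rightarrow> (real ^ 8 \<Rightarrow> 'b \<Rightarrow> real) \<Rightarrow>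
   (real ^ 8 \<Rightarrow> 'b \<Rightarrow> real) \<Rightarrow> 'b chart \<Rightarrow> real ^ 8 \<Rightarrow> complex \<Rightarrow> bool" where
  "C_equation_at \<rho> \<tau> T C c x w \<longleftrightarrow>
     of_real (dalembertian (\<lambda>y. C y (chart_inv c w)) x)
     + 2 * of_real (exp (- \<rho> c w) * (tau2 c \<tau> w)\<^sup>2) *
       (d_z (\<lambda>v. of_real (1 / (tau2 c \<tau> v)\<^sup>2) * d_zbar (rloc c (C x)) v) w
        + d_zbar (\<lambda>v. of_real (1 / (tau2 c \<tau> v)\<^sup>2) * d_z (rloc c (C x)) v) w)
     = - of_real (1 / (2 * sqrt 2) * exp (- \<rho> c w)) *
       (d_z (loc c \<tau>) w * d_zbar (rloc c (T x)) w
        + d_zbar (loc c (\<lambda>p. cnj (\<tau> p))) w * d_z (rloc c (T x)) w)"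

text \<open>The decoupled equation \<open>(dalembertian + 4 exp (- \<rho>) d_z d_zbar - \<mu>) F = 0\<close>.\<close>

definition decoupled_equation_at ::
  "real \<Rightarrow> ('b chart \<Rightarrow> complex \<Rightarrow> real) \<Rightarrow> (real ^ 8 \<Rightarrow> 'b \<Rightarrow> real) \<Rightarrow>
   'b chart \<Rightarrow> real ^ 8 \<Rightarrow> complex \<Rightarrow> bool" where
  "decoupled_equation_at \<mu> \<rho> F c x w \<longleftrightarrow>
     of_real (dalembertian (\<lambda>y. F y (chart_inv c w)) x)
     + 4 * of_real (exp (- \<rho> c w)) * d_z (d_zbar (rloc c (F x))) w
     - of_real \<mu> * rloc c (F x) w = 0"

section \<open>Kaluza--Klein modes\<close>

definition L2_inner ::
  "'b chart set \<Rightarrow> ('b chart \<Rightarrow> complex \<Rightarrow> real) \<Rightarrow> ('b \<Rightarrow> real) \<Rightarrow> ('b \<Rightarrow> real) \<Rightarrow> real" where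
  "L2_inner \<A> \<rho> \<psi> \<eta> = surface_integral \<A>
     (\<lambda>c w. exp (\<rho> c w) * (\<psi> (chart_inv c w) * \<eta> (chart_inv c w)))"

text \<open>The polarization of the quadratic form \<open>\<integral> 4 \<bar>d_z \<psi>\<bar>\<^sup>2 d\<^sup>2x\<close> on real functions.\<close>

definition dirichlet_form :: "'b chart set \<Rightarrow> ('b \<Rightarrow> real) \<Rightarrow> ('b \<Rightarrow> real) \<Rightarrow> real" where
  "dirichlet_form \<A> \<psi> \<eta> = surface_integral \<A>
     (\<lambda>c w. 4 * Re (d_z (rloc c \<psi>) w * cnj (d_z (rloc c \<eta>) w)))"

text \<open>Functions of class \<open>C\<^sup>1\<close> off \<open>S\<close> with finite norm and finite form. They are a core of the
  closed form: points have zero capacity in dimension two, so no boundary condition at \<open>S\<close> is left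
  to choose. By elliptic regularity the eigenfunctions of the associated self-adjoint
  operator are smooth off \<open>S\<close>, so they belong to this class.\<close>

definition form_domain ::
  "'b chart set \<Rightarrow> 'b set \<Rightarrow> ('b chart \<Rightarrow> complex \<Rightarrow> real) \<Rightarrow> ('b \<Rightarrow> real) set" where
  "form_domain \<A> S \<rho> = {\<psi>.
     (\<forall>c\<in>\<A>. Ck_on 1 (regular_range S c) (\<lambda>w. \<psi> (chart_inv c w))) \<and>
     surface_integrable \<A> (\<lambda>c w. exp (\<rho> c w) * \<bar>\<psi> (chart_inv c w)\<bar>\<^sup>2) \<and>
     surface_integrable \<A> (\<lambda>c w. 4 * (cmod (d_z (rloc c \<psi>) w))\<^sup>2)}"

text \<open>\<open>\<psi>\<close> is an eigenfunction, with eigenvalue \<open>Msq\<close>, of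
  \<open>- 4 exp (- \<rho>) d_z d_zbar + \<mu>\<close> in the sense of quadratic forms.\<close>

definition form_eigenfunction ::
  "real \<Rightarrow> 'b chart set \<Rightarrow> 'b set \<Rightarrow> ('b chart \<Rightarrow> complex \<Rightarrow> real) \<Rightarrow> ('b \<Rightarrow> real) \<Rightarrow> real \<Rightarrow> bool" where
  "form_eigenfunction \<mu> \<A> S \<rho> \<psi> Msq \<longleftrightarrow>
     \<psi> \<in> form_domain \<A> S \<rho> \<and> (\<exists>p. p \<notin> S \<and> \<psi> p \<noteq> 0) \<and>
     (\<forall>\<eta>\<in>form_domain \<A> S \<rho>.
        dirichlet_form \<A> \<psi> \<eta> + \<mu> * L2_inner \<A> \<rho> \<psi> \<eta> = Msq * L2_inner \<A> \<rho> \<psi> \<eta>)"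

text \<open>Kaluza--Klein modes, of eight-dimensional mass squared \<open>Msq\<close>, of a field obeying the
  decoupled equation with constant \<open>\<mu>\<close>.\<close>

definition KK_mode ::
  "real \<Rightarrow> 'b chart set \<Rightarrow> 'b set \<Rightarrow> ('b chart \<Rightarrow> complex \<Rightarrow> real) \<Rightarrow> ('b \<Rightarrow> real) \<Rightarrow> real \<Rightarrow> bool" where
  "KK_mode \<mu> \<A> S \<rho> \<psi> Msq \<longleftrightarrow>
     (\<forall>c\<in>\<A>. Ck_on 2 (regular_range S c) (\<lambda>w. \<psi> (chart_inv c w))) \<and>
     (\<forall>\<phi>. Ck_on 2 UNIV \<phi> \<and> (\<forall>x. dalembertian \<phi> x - Msq * \<phi> x = 0) \<longrightarrow>
        (\<forall>c\<in>\<A>. \<forall>x. \<forall>w\<in>regular_range S c.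
           decoupled_equation_at \<mu> \<rho> (\<lambda>x p. \<phi> x * \<psi> p) c x w)) \<and>
     form_eigenfunction \<mu> \<A> S \<rho> \<psi> Msq"

text \<open>\<open>\<psi>0\<close> is the lowest mode: it has the least mass squared, and every mode of that mass squared
  is a multiple of it.\<close>

definition lowest_KK_mode ::
  "real \<Rightarrow> 'b chart set \<Rightarrow> 'b set \<Rightarrow> ('b chart \<Rightarrow> complex \<Rightarrow> real) \<Rightarrow> ('b \<Rightarrow> real) \<Rightarrow> real \<Rightarrow> bool" where
  "lowest_KK_mode \<mu> \<A> S \<rho> \<psi>0 Msq0 \<longleftrightarrow>
     KK_mode \<mu> \<A> S \<rho> \<psi>0 Msq0 \<and>
     (\<forall>\<psi> Msq. KK_mode \<mu> \<A> S \<rho> \<psi> Msq \<longrightarrow>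
        Msq0 \<le> Msq \<and> (Msq = Msq0 \<longrightarrow> (\<exists>a. \<forall>p. p \<notin> S \<longrightarrow> \<psi> p = a * \<psi>0 p)))"

end

(* The equations decouple because the derivatives of tau vanish and, for C^2 fields, d_z and d_zbar
   commute. For the spectrum, test the eigenvalue equation with the mode itself:
   (M^2 - mu) |psi|^2 is the Dirichlet form of psi, which is nonnegative and vanishes only for
   constants, because a surface minus finitely many points stays connected. *)
theory Submission
  imports Defs
begin

section \<open>Functions of class \<open>C\<^sup>k\<close>\<close>

text \<open>Two features of the definitions shape the work. \<open>surface_integral\<close> refers
  to the chosen dissection \<open>pieces\<close>, of which nothing is known beyond
  \<open>chart_dissection\<close>: a piece may have empty interior, and its chart cannot be
  prescribed. Strict positivity of an integral therefore comes from null sets: a nonempty open set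
  cannot be null in every piece, because transition maps carry null sets to null sets. Moreover a
  mode may take any value on \<open>S\<close>, so it need not be locally constant at a singular
  point; constancy has to be carried past such a point through a punctured disc around it. The
  constant mode is admissible because the area is finite. Independence of the size holds because the
  spectral statement is proved for every compact base, and a metric multiplied by a positive
  constant gives another one.\<close>

lemma has_derivative_frechet:
  "f differentiable (at x) \<Longrightarrow> (f has_derivative frechet_derivative f (at x)) (at x)"
  by (simp add: frechet_derivative_works)

lemma frechet_derivative_eqI:
  "(f has_derivative f') (at x) \<Longrightarrow> frechet_derivative f (at x) = f'"
  by (metis frechet_derivative_at)

text \<open>\<open>Ck_on\<close> uses derivatives \<open>at x\<close> in the whole space. On an open
  set these see only values in the set, so the first derivatives of \<open>f\<close> and
  \<open>g\<close> agree on \<open>S\<close> and the induction applies to them.\<close>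

lemma Ck_on_cong:
  assumes "open S" "\<And>x. x \<in> S \<Longrightarrow> f x = g x" "Ck_on k S f"
  shows "Ck_on k S g"
  using assms
proof (induction k arbitrary: f g)
  case 0
  then show ?case using continuous_on_cong[of S S f g] by simp
next
  case (Suc k)
  have d: "(g has_derivative frechet_derivative f (at x)) (at x)" if "x \<in> S" for x
    by (rule has_derivative_transform_within_open[OF has_derivative_frechet Suc.prems(1) that])
      (use Suc.prems that in auto)
  have eq: "frechet_derivative f (at x) = frechet_derivative g (at x)" if "x \<in> S" for x
    using frechet_derivative_eqI[OF d[OF that]] by simp
  have "Ck_on k S (\<lambda>x. frechet_derivative g (at x) v)" for v
    by (rule Suc.IH[OF Suc.prems(1), of "\<lambda>x. frechet_derivative f (at x) v"])
      (use Suc.prems(3) eq in simp_all)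
  moreover have "g differentiable (at x)" if "x \<in> S" for x
    unfolding differentiable_def using d[OF that] by blast
  ultimately show ?case by simp
qed

lemma Ck_on_const: "Ck_on k S (\<lambda>_. a)"
  by (induction k arbitrary: a) auto

text \<open>A case split on \<open>k\<close> suffices: \<open>has_derivative\<close> is the same
  relation for both functions, and \<open>frechet_derivative\<close> is a choice from it, so the
  first derivatives are literally equal, even at points where \<open>f\<close> is not
  differentiable.\<close>

lemma Ck_on_add_const: "Ck_on k S f \<Longrightarrow> Ck_on k S (\<lambda>x. a + f x)"
proof (cases k)
  case (Suc n)
  have shift: "((\<lambda>x. b + g x) has_derivative D) F" if "(g has_derivative D) F" for b and g :: "'a \<Rightarrow> 'b" and D F
    using has_derivative_add[OF has_derivative_const that, of b] by simp
  have "((\<lambda>x. a + f x) has_derivative D) F \<longleftrightarrow> (f has_derivative D) F" for D F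
    using shift[of f D F a] shift[of "\<lambda>x. a + f x" D F "- a"] by auto
  then have "frechet_derivative (\<lambda>x. a + f x) F = frechet_derivative f F"
    and "(\<lambda>x. a + f x) differentiable F \<longleftrightarrow> f differentiable F" for F
    by (simp_all add: frechet_derivative_def differentiable_def)
  moreover assume "Ck_on k S f"
  ultimately show ?thesis by (simp add: Suc)
qed (auto intro: continuous_intros)

text \<open>By the chain rule, direction \<open>v\<close> in the slice is direction
  \<open>(0, v)\<close> in the product. This turns the joint regularity of a fluctuation into
  regularity in the base coordinate at a fixed spacetime point.\<close>

lemma Ck_on_slice:
  assumes "open R" "Ck_on k (UNIV \<times> R) f"
  shows "Ck_on k R (\<lambda>w. f (x, w))"
  using assms(2)
proof (induction k arbitrary: f)
  case 0
  then show ?case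
    by (auto intro!: continuous_on_compose2[of "UNIV \<times> R" f R "\<lambda>w. (x, w)"] continuous_intros)
next
  case (Suc k)
  have d: "((\<lambda>w. f (x, w)) has_derivative (\<lambda>v. frechet_derivative f (at (x, w)) (0, v))) (at w)"
    if "w \<in> R" for w
  proof (rule has_derivative_compose[where f = "\<lambda>w. (x, w)"])
    show "((\<lambda>w. (x, w)) has_derivative (\<lambda>v. (0, v))) (at w)"
      by (auto intro!: derivative_eq_intros)
  qed (use Suc.prems that in \<open>auto intro: has_derivative_frechet\<close>)
  have "Ck_on k R (\<lambda>w. frechet_derivative (\<lambda>w. f (x, w)) (at w) v)" for v
    by (rule Ck_on_cong[OF assms(1) _ Suc.IH[of "\<lambda>y. frechet_derivative f (at y) (0, v)"]])
      (use Suc.prems in \<open>simp_all add: frechet_derivative_eqI[OF d]\<close>)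
  moreover have "(\<lambda>w. f (x, w)) differentiable (at w)" if "w \<in> R" for w
    unfolding differentiable_def using d[OF that] by blast
  ultimately show ?case by simp
qed

text \<open>The mean value theorem is used once in each direction on a parallelogram with sides
  \<open>h\<close> times \<open>u\<close> and \<open>v\<close>. The second difference is symmetric
  in \<open>u\<close> and \<open>v\<close>, so exchanging them expresses it through the other mixed
  derivative.\<close>

lemma second_difference_mean_value:
  fixes g :: "'a::real_normed_vector \<Rightarrow> real"
  assumes h: "h > 0"
    and R: "\<And>a b. 0 \<le> a \<Longrightarrow> a \<le> h \<Longrightarrow> 0 \<le> b \<Longrightarrow> b \<le> h \<Longrightarrow> w + a *\<^sub>R u + b *\<^sub>R v \<in> R"
    and g: "\<And>x. x \<in> R \<Longrightarrow> g differentiable (at x)"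
    and g': "\<And>x. x \<in> R \<Longrightarrow> (\<lambda>y. frechet_derivative g (at y) u) differentiable (at x)"
  obtains a b where "0 < a" "a < h" "0 < b" "b < h"
    "g (w + h *\<^sub>R u + h *\<^sub>R v) - g (w + h *\<^sub>R u) - g (w + h *\<^sub>R v) + g w =
       h * h * frechet_derivative (\<lambda>y. frechet_derivative g (at y) u) (at (w + a *\<^sub>R u + b *\<^sub>R v)) v"
proof -
  let ?gu = "\<lambda>y. frechet_derivative g (at y) u"
  have du: "((\<lambda>s. g (w + s *\<^sub>R u + t *\<^sub>R v)) has_real_derivative ?gu (w + s *\<^sub>R u + t *\<^sub>R v)) (at s)"
    if "0 \<le> s" "s \<le> h" "0 \<le> t" "t \<le> h" for s t
  proof -
    have "((\<lambda>s. w + s *\<^sub>R u + t *\<^sub>R v) has_derivative (\<lambda>k. k *\<^sub>R u)) (at s)"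
      by (auto intro!: derivative_eq_intros)
    from has_derivative_compose[OF this has_derivative_frechet[OF g[OF R[OF that]]]] show ?thesis
      using linear_frechet_derivative[OF g[OF R[OF that]]]
      by (simp add: has_field_derivative_def linear_scale mult_commute_abs)
  qed
  have dv: "((\<lambda>t. ?gu (w + s *\<^sub>R u + t *\<^sub>R v)) has_real_derivative
      frechet_derivative ?gu (at (w + s *\<^sub>R u + t *\<^sub>R v)) v) (at t)"
    if "0 \<le> s" "s \<le> h" "0 \<le> t" "t \<le> h" for s t
  proof -
    have "((\<lambda>t. w + s *\<^sub>R u + t *\<^sub>R v) has_derivative (\<lambda>k. k *\<^sub>R v)) (at t)"
      by (auto intro!: derivative_eq_intros)
    from has_derivative_compose[OF this has_derivative_frechet[OF g'[OF R[OF that]]]] show ?thesis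
      using linear_frechet_derivative[OF g'[OF R[OF that]]]
      by (simp add: has_field_derivative_def linear_scale mult_commute_abs)
  qed
  \<comment> \<open>The function of \<open>s\<close> is the difference of \<open>g\<close> between
    the two sides parallel to \<open>u\<close>. The zero multiples of \<open>u\<close> and
    \<open>v\<close> are kept so that the terms match \<open>du\<close> and
    \<open>dv\<close>.\<close>
  have "\<exists>a>0. a < h \<and>
    (g (w + h *\<^sub>R u + h *\<^sub>R v) - g (w + h *\<^sub>R u + 0 *\<^sub>R v)) -
    (g (w + 0 *\<^sub>R u + h *\<^sub>R v) - g (w + 0 *\<^sub>R u + 0 *\<^sub>R v)) =
    (h - 0) * (?gu (w + a *\<^sub>R u + h *\<^sub>R v) - ?gu (w + a *\<^sub>R u + 0 *\<^sub>R v))"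
    by (rule MVT2[OF h], rule DERIV_diff; rule du) (use h in auto)
  then obtain a where a: "0 < a" "a < h"
    "(g (w + h *\<^sub>R u + h *\<^sub>R v) - g (w + h *\<^sub>R u + 0 *\<^sub>R v)) -
     (g (w + 0 *\<^sub>R u + h *\<^sub>R v) - g (w + 0 *\<^sub>R u + 0 *\<^sub>R v)) =
     (h - 0) * (?gu (w + a *\<^sub>R u + h *\<^sub>R v) - ?gu (w + a *\<^sub>R u + 0 *\<^sub>R v))"
    by blast
  have "\<exists>b>0. b < h \<and> ?gu (w + a *\<^sub>R u + h *\<^sub>R v) - ?gu (w + a *\<^sub>R u + 0 *\<^sub>R v) =
     (h - 0) * frechet_derivative ?gu (at (w + a *\<^sub>R u + b *\<^sub>R v)) v"
    by (rule MVT2[OF h], rule dv) (use a in auto)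
  then obtain b where b: "0 < b" "b < h"
    "?gu (w + a *\<^sub>R u + h *\<^sub>R v) - ?gu (w + a *\<^sub>R u + 0 *\<^sub>R v) =
     (h - 0) * frechet_derivative ?gu (at (w + a *\<^sub>R u + b *\<^sub>R v)) v"
    by blast
  show ?thesis
    using that[OF a(1,2) b(1,2)] a(3) b(3) by simp
qed

text \<open>Schwarz's theorem: on shrinking parallelograms at \<open>w\<close> the two mixed
  derivatives agree at nearby, generally different points, and continuity of both carries the
  equality to \<open>w\<close>.\<close>

lemma Ck_on_2_symmetric:
  fixes g :: "'a::real_normed_vector \<Rightarrow> real"
  assumes R: "open R" and g: "Ck_on 2 R g" and w: "w \<in> R"
  shows "frechet_derivative (\<lambda>y. frechet_derivative g (at y) u) (at w) v =
    frechet_derivative (\<lambda>y. frechet_derivative g (at y) v) (at w) u" (is "?A w = ?B w")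
proof -
  have d1: "\<And>x. x \<in> R \<Longrightarrow> g differentiable (at x)"
    and d2: "\<And>x k. x \<in> R \<Longrightarrow> (\<lambda>y. frechet_derivative g (at y) k) differentiable (at x)"
    and c: "continuous_on R ?A" "continuous_on R ?B"
    using g by (auto simp: numeral_2_eq_2)
  obtain e where e: "e > 0" "ball w e \<subseteq> R" using R w open_contains_ball by blast
  \<comment> \<open>The summand 1 keeps \<open>M\<close> positive when \<open>u\<close> and
    \<open>v\<close> both vanish.\<close>
  define M where "M = norm u + norm v + 1"
  have M: "M > 0" unfolding M_def by (simp add: add_nonneg_pos)
  \<comment> \<open>The factor \<open>e / (2 * M)\<close> keeps \<open>h n * M\<close> at most
    \<open>e / 2\<close>, so the closed parallelogram of size \<open>h n\<close> lies in the ball of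
    radius \<open>e\<close>.\<close>
  define h where "h = (\<lambda>n. e / (2 * M) * inverse (real (Suc n)))"
  have h: "h n > 0" "h n * M < e" for n
  proof -
    show "h n > 0" using e M by (simp add: h_def)
    have "h n = e / (2 * M) / real (Suc n)" by (simp only: h_def divide_inverse)
    then have "h n * M = e / 2 / real (Suc n)" using M by simp
    also have "\<dots> \<le> e / 2" using e by (simp add: field_simps)
    finally show "h n * M < e" using e by simp
  qed
  have dist: "norm (a *\<^sub>R u + b *\<^sub>R v) \<le> h n * M" if "0 \<le> a" "a \<le> h n" "0 \<le> b" "b \<le> h n" for a b n
  proof -
    have "norm (a *\<^sub>R u + b *\<^sub>R v) \<le> a * norm u + b * norm v"
      using norm_triangle_ineq[of "a *\<^sub>R u" "b *\<^sub>R v"] that by simp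
    also have "\<dots> \<le> h n * norm u + h n * norm v"
      using that by (intro add_mono mult_right_mono) auto
    also have "\<dots> \<le> h n * M" using h(1)[of n] by (simp add: M_def algebra_simps)
    finally show ?thesis .
  qed
  have inR: "w + a *\<^sub>R u + b *\<^sub>R v \<in> R" if "0 \<le> a" "a \<le> h n" "0 \<le> b" "b \<le> h n" for a b n
    using dist[OF that] h(2)[of n] e(2) by (auto simp: dist_norm add.assoc norm_minus_commute subset_iff)
  \<comment> \<open>Both evaluation points are packed into one pair, so that a single application of
    choice yields the two sequences.\<close>
  have "\<forall>n. \<exists>x. norm (fst x - w) \<le> h n * M \<and> norm (snd x - w) \<le> h n * M \<and>
      fst x \<in> R \<and> snd x \<in> R \<and> ?A (fst x) = ?B (snd x)"
  proof
    fix n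
    obtain a b where ab: "0 < a" "a < h n" "0 < b" "b < h n"
      "g (w + h n *\<^sub>R u + h n *\<^sub>R v) - g (w + h n *\<^sub>R u) - g (w + h n *\<^sub>R v) + g w =
       h n * h n * ?A (w + a *\<^sub>R u + b *\<^sub>R v)"
      by (rule second_difference_mean_value[OF h(1)[of n] inR[where n = n] d1 d2])
    have inR': "w + b *\<^sub>R v + a *\<^sub>R u \<in> R" if "0 \<le> b" "b \<le> h n" "0 \<le> a" "a \<le> h n" for a b
      using inR[OF that(3,4,1,2)] by (simp add: algebra_simps)
    obtain a' b' where ab': "0 < b'" "b' < h n" "0 < a'" "a' < h n"
      "g (w + h n *\<^sub>R v + h n *\<^sub>R u) - g (w + h n *\<^sub>R v) - g (w + h n *\<^sub>R u) + g w =
       h n * h n * ?B (w + b' *\<^sub>R v + a' *\<^sub>R u)"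
      by (rule second_difference_mean_value[OF h(1)[of n] inR' d1 d2])
    \<comment> \<open>Both sides are the same second difference, expanded in the two orders.\<close>
    have "h n * h n * ?A (w + a *\<^sub>R u + b *\<^sub>R v) = h n * h n * ?B (w + b' *\<^sub>R v + a' *\<^sub>R u)"
      using ab(5) ab'(5) by (simp add: algebra_simps)
    then have "?A (w + a *\<^sub>R u + b *\<^sub>R v) = ?B (w + b' *\<^sub>R v + a' *\<^sub>R u)"
      using h(1)[of n] by simp
    moreover have "norm (a *\<^sub>R u + b *\<^sub>R v) \<le> h n * M" "norm (b' *\<^sub>R v + a' *\<^sub>R u) \<le> h n * M"
      using dist[of a n b] dist[of a' n b'] ab ab' by (auto simp: add.commute)
    moreover have "w + a *\<^sub>R u + b *\<^sub>R v \<in> R" "w + b' *\<^sub>R v + a' *\<^sub>R u \<in> R"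
      using inR[of a n b] inR'[of b' a'] ab ab' by auto
    ultimately show "\<exists>x. norm (fst x - w) \<le> h n * M \<and> norm (snd x - w) \<le> h n * M \<and>
      fst x \<in> R \<and> snd x \<in> R \<and> ?A (fst x) = ?B (snd x)"
      by (intro exI[of _ "(w + a *\<^sub>R u + b *\<^sub>R v, w + b' *\<^sub>R v + a' *\<^sub>R u)"])
        (simp add: add.assoc)
  qed
  from choice[OF this] obtain x where
    x: "\<forall>n. norm (fst (x n) - w) \<le> h n * M \<and> norm (snd (x n) - w) \<le> h n * M \<and>
      fst (x n) \<in> R \<and> snd (x n) \<in> R \<and> ?A (fst (x n)) = ?B (snd (x n))"
    by (elim exE)
  define p q where "p = fst \<circ> x" and "q = snd \<circ> x"
  have pq: "\<And>n. norm (p n - w) \<le> h n * M" "\<And>n. norm (q n - w) \<le> h n * M"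
    "\<And>n. p n \<in> R" "\<And>n. q n \<in> R" "\<And>n. ?A (p n) = ?B (q n)"
    using x by (simp_all add: p_def q_def)
  have "h \<longlonglongrightarrow> 0"
    unfolding h_def by (rule tendsto_mult_right_zero[OF LIMSEQ_inverse_real_of_nat])
  then have "(\<lambda>n. h n * M) \<longlonglongrightarrow> 0" by (rule tendsto_mult_left_zero)
  then have "(\<lambda>n. p n - w) \<longlonglongrightarrow> 0" "(\<lambda>n. q n - w) \<longlonglongrightarrow> 0"
    by (rule Lim_null_comparison[rotated]; simp add: pq)+
  then have "p \<longlonglongrightarrow> w" "q \<longlonglongrightarrow> w" by (simp_all add: LIM_zero_iff)
  then have "(\<lambda>n. ?A (p n)) \<longlonglongrightarrow> ?A w" "(\<lambda>n. ?B (q n)) \<longlonglongrightarrow> ?B w"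
    using continuous_on_tendsto_compose[OF c(1) _ w, of p sequentially]
      continuous_on_tendsto_compose[OF c(2) _ w, of q sequentially] pq(3,4) by simp_all
  then show ?thesis unfolding pq(5) by (rule LIMSEQ_unique)
qed

section \<open>Wirtinger derivatives of real functions\<close>

lemma frechet_derivative_of_real:
  fixes g :: "complex \<Rightarrow> real"
  assumes "g differentiable (at w)"
  shows "((\<lambda>v. complex_of_real (g v)) has_derivative
      (\<lambda>v. of_real (frechet_derivative g (at w) v))) (at w)"
    and "frechet_derivative (\<lambda>v. complex_of_real (g v)) (at w) =
      (\<lambda>v. of_real (frechet_derivative g (at w) v))"
proof -
  show *: "((\<lambda>v. complex_of_real (g v)) has_derivative
      (\<lambda>v. of_real (frechet_derivative g (at w) v))) (at w)"
    using has_derivative_frechet[OF assms] by (rule has_derivative_of_real)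
  show "frechet_derivative (\<lambda>v. complex_of_real (g v)) (at w) =
      (\<lambda>v. of_real (frechet_derivative g (at w) v))"
    by (rule frechet_derivative_eqI[OF *])
qed

lemma d_z_of_real:
  assumes "g differentiable (at w)"
  shows "d_z (\<lambda>v. complex_of_real (g v)) w =
      (of_real (frechet_derivative g (at w) 1) - \<i> * of_real (frechet_derivative g (at w) \<i>)) / 2"
    and "d_zbar (\<lambda>v. complex_of_real (g v)) w =
      (of_real (frechet_derivative g (at w) 1) + \<i> * of_real (frechet_derivative g (at w) \<i>)) / 2"
  by (simp_all add: d_z_def d_zbar_def frechet_derivative_of_real[OF assms])

text \<open>For real \<open>g\<close> the real and imaginary parts of \<open>d_z\<close> are, up to
  sign, half the two partial derivatives. Hence \<open>d_z\<close> alone controls the whole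
  derivative, which fails for complex functions such as conjugation.\<close>

lemma d_z_of_real_eq_0_iff:
  assumes "g differentiable (at w)"
  shows "d_z (\<lambda>v. complex_of_real (g v)) w = 0 \<longleftrightarrow> frechet_derivative g (at w) = (\<lambda>_. 0)"
proof -
  have "frechet_derivative g (at w) h =
      Re h * frechet_derivative g (at w) 1 + Im h * frechet_derivative g (at w) \<i>" for h
  proof -
    have "h = Re h *\<^sub>R 1 + Im h *\<^sub>R \<i>" by (simp add: complex_eq_iff)
    then show ?thesis
      using linear_frechet_derivative[OF assms]
      by (smt (verit) linear_add linear_scale real_scaleR_def)
  qed
  then have "frechet_derivative g (at w) = (\<lambda>_. 0) \<longleftrightarrow>
      frechet_derivative g (at w) 1 = 0 \<and> frechet_derivative g (at w) \<i> = 0"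
    by (metis add.right_neutral ext mult_zero_right)
  then show ?thesis by (simp add: d_z_of_real[OF assms] complex_eq_iff)
qed

lemma has_derivative_d_z_of_real:
  assumes R: "open R" and g: "Ck_on 2 R g" and w: "w \<in> R"
  shows "(d_z (\<lambda>v. complex_of_real (g v)) has_derivative (\<lambda>h.
      (of_real (frechet_derivative (\<lambda>y. frechet_derivative g (at y) 1) (at w) h) -
       \<i> * of_real (frechet_derivative (\<lambda>y. frechet_derivative g (at y) \<i>) (at w) h)) / 2)) (at w)"
    and "(d_zbar (\<lambda>v. complex_of_real (g v)) has_derivative (\<lambda>h.
      (of_real (frechet_derivative (\<lambda>y. frechet_derivative g (at y) 1) (at w) h) +
       \<i> * of_real (frechet_derivative (\<lambda>y. frechet_derivative g (at y) \<i>) (at w) h)) / 2)) (at w)"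
proof -
  have d1: "\<And>x. x \<in> R \<Longrightarrow> g differentiable (at x)"
    and d2: "\<And>k. (\<lambda>y. frechet_derivative g (at y) k) differentiable (at w)"
    using g w by (auto simp: numeral_2_eq_2)
  note [derivative_intros] = frechet_derivative_of_real(1)[OF d2]
  show "(d_z (\<lambda>v. complex_of_real (g v)) has_derivative (\<lambda>h.
      (of_real (frechet_derivative (\<lambda>y. frechet_derivative g (at y) 1) (at w) h) -
       \<i> * of_real (frechet_derivative (\<lambda>y. frechet_derivative g (at y) \<i>) (at w) h)) / 2)) (at w)"
    by (rule has_derivative_transform_within_open[OF _ R w d_z_of_real(1)[OF d1, symmetric]])
      (auto intro!: derivative_eq_intros)
  show "(d_zbar (\<lambda>v. complex_of_real (g v)) has_derivative (\<lambda>h.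
      (of_real (frechet_derivative (\<lambda>y. frechet_derivative g (at y) 1) (at w) h) +
       \<i> * of_real (frechet_derivative (\<lambda>y. frechet_derivative g (at y) \<i>) (at w) h)) / 2)) (at w)"
    by (rule has_derivative_transform_within_open[OF _ R w d_z_of_real(2)[OF d1, symmetric]])
      (auto intro!: derivative_eq_intros)
qed

text \<open>Both orders give a quarter of the Laplacian once the mixed partial derivatives cancel by
  symmetry.\<close>

lemma d_z_d_zbar_commute:
  assumes R: "open R" and g: "Ck_on 2 R g" and w: "w \<in> R"
  shows "d_zbar (d_z (\<lambda>v. complex_of_real (g v))) w = d_z (d_zbar (\<lambda>v. complex_of_real (g v))) w"
  unfolding d_zbar_def[of "d_z _"] d_z_def[of "d_zbar _"]
    frechet_derivative_eqI[OF has_derivative_d_z_of_real(1)[OF assms]]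
    frechet_derivative_eqI[OF has_derivative_d_z_of_real(2)[OF assms]]
    Ck_on_2_symmetric[OF assms, of 1 \<i>]
  by (simp add: field_simps)

lemma d_z_const [simp]: "d_z (\<lambda>_. a) = (\<lambda>_. 0)" "d_zbar (\<lambda>_. a) = (\<lambda>_. 0)"
  by (auto simp: d_z_def d_zbar_def)

lemma d_z_cmult:
  assumes "f differentiable (at w)"
  shows "d_z (\<lambda>v. a * f v) w = a * d_z f w" "d_zbar (\<lambda>v. a * f v) w = a * d_zbar f w"
proof -
  have "frechet_derivative (\<lambda>v. a * f v) (at w) = (\<lambda>h. a * frechet_derivative f (at w) h)"
    by (intro frechet_derivative_eqI has_derivative_mult_right has_derivative_frechet assms)
  then show "d_z (\<lambda>v. a * f v) w = a * d_z f w" "d_zbar (\<lambda>v. a * f v) w = a * d_zbar f w"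
    by (simp_all add: d_z_def d_zbar_def algebra_simps)
qed

section \<open>Charts\<close>

lemma is_chartD:
  assumes "is_chart c"
  shows "open (fst c)" "open (snd c ` fst c)"
    "\<And>p. p \<in> fst c \<Longrightarrow> chart_inv c (snd c p) = p"
    "inj_on (snd c) (fst c)"
    "continuous_on (fst c) (snd c)" "continuous_on (snd c ` fst c) (chart_inv c)"
  using assms by (auto simp: is_chart_def homeomorphism_def intro: inj_on_inverseI)

lemma chart_image_open:
  assumes c: "is_chart c" and V: "open V" "V \<subseteq> fst c"
  shows "open (snd c ` V)"
proof -
  have "openin (top_of_set (fst c)) V"
    using V by (metis inf.absorb_iff2 openin_open)
  then have "openin (top_of_set (snd c ` fst c)) (snd c ` V)"
    using c homeomorphism_imp_open_map unfolding is_chart_def by blast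
  then show ?thesis using is_chartD(2)[OF c] openin_open_trans by blast
qed

lemma holomorphic_atlasD:
  assumes "holomorphic_atlas \<A>"
  shows "\<And>c. c \<in> \<A> \<Longrightarrow> is_chart c" "\<And>p. \<exists>c\<in>\<A>. p \<in> fst c"
  using assms unfolding holomorphic_atlas_def by blast+

lemma transition_has_derivative:
  assumes A: "holomorphic_atlas \<A>" and c: "c \<in> \<A>" "c' \<in> \<A>" and p: "p \<in> fst c" "p \<in> fst c'"
  obtains L where "((\<lambda>w. snd c' (chart_inv c w)) has_derivative L) (at (snd c p))"
proof -
  note ch = holomorphic_atlasD(1)[OF A]
  have "(snd c' \<circ> chart_inv c) holomorphic_on (snd c ` (fst c \<inter> fst c'))"
    using A c unfolding holomorphic_atlas_def by blast
  moreover have "open (snd c ` (fst c \<inter> fst c'))"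
    using is_chartD(1)[OF ch[OF c(1)]] is_chartD(1)[OF ch[OF c(2)]]
    by (intro chart_image_open[OF ch[OF c(1)]]) auto
  moreover have "snd c p \<in> snd c ` (fst c \<inter> fst c')" using p by blast
  ultimately have "(snd c' \<circ> chart_inv c) field_differentiable (at (snd c p))"
    by (rule holomorphic_on_imp_differentiable_at)
  then show ?thesis
    using that by (auto simp: field_differentiable_def has_field_derivative_def o_def)
qed

text \<open>A chart maps part of a finite open set onto a finite nonempty open set of the plane,
  which does not exist. The lemma supplies regular points inside open sets.\<close>

lemma open_minus_finite_nonempty:
  fixes \<A> :: "'b::t2_space chart set" and V S :: "'b set"
  assumes A: "holomorphic_atlas \<A>" and V: "open V" "V \<noteq> {}" and S: "finite S"
  shows "V - S \<noteq> {}"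
proof
  assume *: "V - S = {}"
  obtain p where p: "p \<in> V" using V by blast
  obtain c where c: "c \<in> \<A>" "p \<in> fst c" using holomorphic_atlasD(2)[OF A] by blast
  note ch = holomorphic_atlasD(1)[OF A c(1)]
  have "open (snd c ` (V \<inter> fst c))"
    using is_chartD(1)[OF ch] V by (intro chart_image_open[OF ch]) auto
  moreover have "snd c ` (V \<inter> fst c) \<noteq> {}" using p c by blast
  moreover have "finite V" using * S by (meson Diff_eq_empty_iff finite_subset)
  then have "finite (snd c ` (V \<inter> fst c))" by simp
  ultimately show False using finite_imp_not_open by blast
qed

section \<open>Null sets and strict positivity of surface integrals\<close>

lemma chart_dissectionD:
  assumes D: "chart_dissection \<A> D" and P: "(c, A) \<in> D"
  shows "c \<in> \<A>" "A \<subseteq> fst c"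
proof -
  have "\<forall>(c, A)\<in>D. c \<in> \<A> \<and> A \<subseteq> fst c \<and> snd c ` A \<in> sets borel"
    using D by (simp add: chart_dissection_def)
  from bspec[OF this P] show "c \<in> \<A>" "A \<subseteq> fst c" by simp_all
qed

text \<open>Transition maps are differentiable, so they preserve null sets.\<close>

lemma dissection_not_negligible:
  fixes \<A> :: "'b::topological_space chart set" and V :: "'b set"
  assumes A: "holomorphic_atlas \<A>" and D: "chart_dissection \<A> D" and V: "open V" "V \<noteq> {}"
  shows "\<exists>c A. (c, A) \<in> D \<and> \<not> negligible (snd c ` (V \<inter> A))"
proof (rule ccontr)
  assume "\<not> ?thesis"
  then have neg: "negligible (snd c ` (V \<inter> A))" if "(c, A) \<in> D" for c A
    using that by blast
  obtain p where p: "p \<in> V" using V by blast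
  obtain c0 where c0: "c0 \<in> \<A>" "p \<in> fst c0" using holomorphic_atlasD(2)[OF A] by blast
  note ch = holomorphic_atlasD(1)[OF A]
  define N where "N P = (\<lambda>w. snd c0 (chart_inv (fst P) w)) ` (snd (fst P) ` (V \<inter> fst c0 \<inter> snd P))"
    for P
  note DA = chart_dissectionD[OF D]
  have "negligible (N (c, A))" if P: "(c, A) \<in> D" for c A
    unfolding N_def fst_conv snd_conv
  proof (rule negligible_differentiable_image_negligible)
    show "negligible (snd c ` (V \<inter> fst c0 \<inter> A))"
      by (rule negligible_subset[OF neg[OF P]]) blast
    show "(\<lambda>w. snd c0 (chart_inv c w)) differentiable_on snd c ` (V \<inter> fst c0 \<inter> A)"
      unfolding differentiable_on_def
    proof
      fix w assume "w \<in> snd c ` (V \<inter> fst c0 \<inter> A)"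
      then obtain q where q: "w = snd c q" "q \<in> fst c" "q \<in> fst c0" using DA[OF P] by blast
      obtain L where "((\<lambda>w. snd c0 (chart_inv c w)) has_derivative L) (at (snd c q))"
        using transition_has_derivative[OF A DA(1)[OF P] c0(1) q(2,3)] .
      then show "(\<lambda>w. snd c0 (chart_inv c w)) differentiable
          (at w within snd c ` (V \<inter> fst c0 \<inter> A))"
        unfolding q(1) differentiable_def using has_derivative_at_withinI by blast
    qed
  qed simp
  then have "negligible (\<Union>P\<in>D. N P)"
    using D by (intro negligible_Union) (auto simp: chart_dissection_def)
  moreover have "snd c0 ` (V \<inter> fst c0) \<subseteq> (\<Union>P\<in>D. N P)"
  proof
    fix w assume "w \<in> snd c0 ` (V \<inter> fst c0)"
    then obtain q where q: "w = snd c0 q" "q \<in> V" "q \<in> fst c0" by blast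
    have "q \<in> (\<Union>P\<in>D. snd P)" using D by (simp add: chart_dissection_def)
    then obtain c A where P: "(c, A) \<in> D" "q \<in> A" by (metis UN_E prod.collapse)
    have "chart_inv c (snd c q) = q" using is_chartD(3)[OF ch[OF DA(1)[OF P(1)]]] DA(2)[OF P(1)] P(2) by blast
    then have "w \<in> N (c, A)"
      unfolding N_def fst_conv snd_conv image_image using q P by force
    then show "w \<in> (\<Union>P\<in>D. N P)" using P by blast
  qed
  ultimately have "negligible (snd c0 ` (V \<inter> fst c0))" using negligible_subset by blast
  moreover have "open (snd c0 ` (V \<inter> fst c0))"
    using is_chartD(1)[OF ch[OF c0(1)]] V by (intro chart_image_open[OF ch[OF c0(1)]]) auto
  moreover have "snd c0 ` (V \<inter> fst c0) \<noteq> {}" using p c0 by blast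
  ultimately show False using open_not_negligible by blast
qed

lemma set_integral_zero_negligible:
  fixes f :: "complex \<Rightarrow> real"
  assumes f: "set_integrable lborel X f" "\<And>x. f x \<ge> 0" and z: "(LINT x:X|lborel. f x) = 0"
  shows "negligible {x \<in> X. f x \<noteq> 0}"
proof -
  have "AE x in lborel. indicat_real X x *\<^sub>R f x = 0"
    using integral_nonneg_eq_0_iff_AE[of lborel "\<lambda>x. indicat_real X x *\<^sub>R f x"] f z
    by (simp add: set_integrable_def set_lebesgue_integral_def)
  then obtain N where N: "N \<in> null_sets lborel" "{x. indicat_real X x *\<^sub>R f x \<noteq> 0} \<subseteq> N"
    by (auto elim!: AE_E simp: null_sets_def)
  \<comment> \<open>\<open>negligible\<close> refers to the completed Lebesgue measure, whereas
    \<open>N\<close> is a null set of \<open>lborel\<close>.\<close>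
  have "negligible N"
    using N(1) null_sets_completionI by (simp add: negligible_iff_null_sets)
  moreover have "{x \<in> X. f x \<noteq> 0} \<subseteq> N" using N(2) by (auto simp: subset_iff)
  ultimately show ?thesis by (rule negligible_subset)
qed

lemma surface_integral_nonneg:
  assumes "\<And>c w. d c w \<ge> 0"
  shows "surface_integral \<A> d \<ge> 0"
  unfolding surface_integral_def set_lebesgue_integral_def
  by (auto intro!: sum_nonneg Bochner_Integration.integral_nonneg simp: assms)

lemma chart_dissection_pieces:
  fixes \<A> :: "'b::topological_space chart set"
  assumes "holomorphic_atlas \<A>" "compact (UNIV :: 'b set)"
  shows "chart_dissection \<A> (pieces \<A>)"
  unfolding pieces_def using chart_dissection_exists[OF assms] by (rule someI_ex)

text \<open>Some piece meets \<open>V\<close> in a set of non-null coordinate image and contributes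
  a positive amount; the others contribute at least zero. That piece and its chart are unknown, so
  \<open>pos\<close> asks for a nonzero density in every chart around a point of
  \<open>V\<close>.\<close>

lemma surface_integral_pos:
  fixes \<A> :: "'b::topological_space chart set" and V :: "'b set"
  assumes A: "holomorphic_atlas \<A>" and K: "compact (UNIV :: 'b set)"
    and d: "surface_integrable \<A> d" "\<And>c w. d c w \<ge> 0"
    and V: "open V" "V \<noteq> {}" and pos: "\<And>c p. c \<in> \<A> \<Longrightarrow> p \<in> V \<Longrightarrow> p \<in> fst c \<Longrightarrow> d c (snd c p) \<noteq> 0"
  shows "surface_integral \<A> d > 0"
proof -
  note D = chart_dissection_pieces[OF A K]
  obtain c A where P: "(c, A) \<in> pieces \<A>" and nn: "\<not> negligible (snd c ` (V \<inter> A))"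
    using dissection_not_negligible[OF A D V] by blast
  note cA = chart_dissectionD[OF D P]
  have sub: "snd c ` (V \<inter> A) \<subseteq> {w \<in> snd c ` A. d c w \<noteq> 0}" using pos cA by blast
  have "(LINT w:snd c ` A|lborel. d c w) \<noteq> 0"
  proof
    assume "(LINT w:snd c ` A|lborel. d c w) = 0"
    moreover have "set_integrable lborel (snd c ` A) (d c)"
      using d(1) P unfolding surface_integrable_def by blast
    ultimately have "negligible {w \<in> snd c ` A. d c w \<noteq> 0}"
      using d(2) set_integral_zero_negligible by blast
    with nn sub show False using negligible_subset by blast
  qed
  moreover have nonneg: "(LINT w:snd c ` A|lborel. d c w) \<ge> 0" for c :: "'b chart" and A
    unfolding set_lebesgue_integral_def by (intro Bochner_Integration.integral_nonneg) (simp add: d(2))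
  ultimately have "0 < (LINT w:snd c ` A|lborel. d c w)" by (simp add: less_le)
  also have "\<dots> \<le> surface_integral \<A> d"
    unfolding surface_integral_def
    using member_le_sum[of "(c, A)" "pieces \<A>" "\<lambda>(c, A). LINT w:snd c ` A|lborel. d c w"] P D nonneg
    by (auto simp: chart_dissection_def)
  finally show ?thesis .
qed

section \<open>Regular points and functions with vanishing derivative\<close>

lemma regular_range_open:
  fixes c :: "'b::t2_space chart"
  assumes c: "is_chart c" and S: "finite S"
  shows "open (regular_range S c)"
  unfolding regular_range_def
  using is_chartD(1)[OF c] finite_imp_closed[OF S] by (intro chart_image_open[OF c]) auto

lemma open_regular_nonzero:
  fixes c :: "'b::t2_space chart" and f :: "complex \<Rightarrow> 'a::t1_space"
  assumes c: "is_chart c" and S: "finite S" and f: "continuous_on (regular_range S c) f"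
  shows "open {p \<in> fst c - S. f (snd c p) \<noteq> a}"
proof -
  have o: "open (fst c - S)" using is_chartD(1)[OF c] finite_imp_closed[OF S] by auto
  have "continuous_on (fst c - S) (\<lambda>p. f (snd c p))"
    by (rule continuous_on_compose2[OF f])
      (auto simp: regular_range_def intro: continuous_on_subset[OF is_chartD(5)[OF c]])
  then have "open ((\<lambda>p. f (snd c p)) -` (- {a}) \<inter> (fst c - S))"
    using o continuous_on_open_vimage by blast
  moreover have "(\<lambda>p. f (snd c p)) -` (- {a}) \<inter> (fst c - S) = {p \<in> fst c - S. f (snd c p) \<noteq> a}"
    by auto
  ultimately show ?thesis by simp
qed

text \<open>The coordinate derivative depends on the chart, but by the chain rule through the
  transition map its vanishing does not. This provides the condition in all charts that
  \<open>surface_integral_pos\<close> demands.\<close>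

lemma chart_derivative_zero_transfer:
  assumes A: "holomorphic_atlas \<A>" and c: "c \<in> \<A>" "c' \<in> \<A>" and p: "p \<in> fst c" "p \<in> fst c'"
    and z: "((\<lambda>w. \<psi> (chart_inv c w)) has_derivative (\<lambda>_. 0)) (at (snd c p))"
  shows "((\<lambda>w. \<psi> (chart_inv c' w)) has_derivative (\<lambda>_. 0)) (at (snd c' p))"
proof -
  note ch = holomorphic_atlasD(1)[OF A]
  obtain L where L: "((\<lambda>w. snd c (chart_inv c' w)) has_derivative L) (at (snd c' p))"
    using transition_has_derivative[OF A c(2,1) p(2,1)] .
  have "chart_inv c' (snd c' p) = p" using is_chartD(3)[OF ch[OF c(2)]] p by blast
  then have "((\<lambda>w. \<psi> (chart_inv c w)) has_derivative (\<lambda>_. 0)) (at (snd c (chart_inv c' (snd c' p))))"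
    using z by simp
  from has_derivative_compose[OF L this]
  have "((\<lambda>w. \<psi> (chart_inv c (snd c (chart_inv c' w)))) has_derivative (\<lambda>_. 0)) (at (snd c' p))" .
  then show ?thesis
  proof (rule has_derivative_transform_within_open)
    show "open (snd c' ` (fst c' \<inter> fst c))"
      using is_chartD(1)[OF ch[OF c(1)]] is_chartD(1)[OF ch[OF c(2)]]
      by (intro chart_image_open[OF ch[OF c(2)]]) auto
    show "snd c' p \<in> snd c' ` (fst c' \<inter> fst c)" using p by blast
    show "\<psi> (chart_inv c (snd c (chart_inv c' w))) = \<psi> (chart_inv c' w)"
      if "w \<in> snd c' ` (fst c' \<inter> fst c)" for w
      using that is_chartD(3)[OF ch[OF c(1)]] is_chartD(3)[OF ch[OF c(2)]] by force
  qed
qed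

text \<open>Removing finitely many points from a coordinate disc leaves it connected, so a function with
  vanishing derivative off \<open>S\<close> is constant off \<open>S\<close> near every point, including those of \<open>S\<close>.\<close>

lemma constant_off_finite:
  fixes \<A> :: "'b::t2_space chart set" and \<psi> :: "'b \<Rightarrow> real"
  assumes A: "holomorphic_atlas \<A>" and K: "connected (UNIV :: 'b set)" and S: "finite S"
    and z: "\<And>c p. c \<in> \<A> \<Longrightarrow> p \<in> fst c - S \<Longrightarrow>
      ((\<lambda>w. \<psi> (chart_inv c w)) has_derivative (\<lambda>_. 0)) (at (snd c p))"
  shows "\<exists>a. \<forall>p. p \<notin> S \<longrightarrow> \<psi> p = a"
proof -
  have loc: "\<exists>N a. open N \<and> p \<in> N \<and> (\<forall>q\<in>N - S. \<psi> q = a)" for p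
  proof -
    obtain c where c: "c \<in> \<A>" "p \<in> fst c" using holomorphic_atlasD(2)[OF A] by blast
    note ch = holomorphic_atlasD(1)[OF A c(1)]
    obtain e where e: "e > 0" "ball (snd c p) e \<subseteq> snd c ` fst c"
      using is_chartD(2)[OF ch] c(2) open_contains_ball by blast
    define N where "N = snd c -` ball (snd c p) e \<inter> fst c"
    \<comment> \<open>Removing countably many points from a connected open set of the plane keeps it
      connected, so one constant serves on all of \<open>B\<close>, also when \<open>p\<close>
      itself is singular.\<close>
    define B where "B = ball (snd c p) e - snd c ` (S \<inter> fst c)"
    have "open N"
      unfolding N_def using is_chartD(1,5)[OF ch] continuous_on_open_vimage by blast
    have fin: "finite (snd c ` (S \<inter> fst c))" using S by simp
    have "open B" unfolding B_def using finite_imp_closed[OF fin] by auto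
    have "connected B"
      unfolding B_def using fin by (intro connected_open_diff_countable) (simp_all add: countable_finite)
    have reg: "\<exists>q\<in>fst c - S. w = snd c q" if "w \<in> B" for w
      using that e(2) unfolding B_def by blast
    have "(\<lambda>w. \<psi> (chart_inv c w)) constant_on B"
    proof (rule has_derivative_zero_connected_constant_on[where K = "{}"])
      have d: "((\<lambda>w. \<psi> (chart_inv c w)) has_derivative (\<lambda>_. 0)) (at w within B)" if "w \<in> B" for w
      proof -
        obtain q where q: "q \<in> fst c - S" "w = snd c q" using reg[OF \<open>w \<in> B\<close>] by blast
        show ?thesis unfolding q(2) by (rule has_derivative_at_withinI[OF z[OF c(1) q(1)]])
      qed
      then show "continuous_on B (\<lambda>w. \<psi> (chart_inv c w))"
        unfolding continuous_on_eq_continuous_within using has_derivative_continuous by blast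
      show "\<forall>x\<in>B - {}. ((\<lambda>w. \<psi> (chart_inv c w)) has_derivative (\<lambda>_. 0)) (at x within B)"
        using d by simp
    qed (use \<open>open B\<close> \<open>connected B\<close> in auto)
    then obtain a where a: "\<And>w. w \<in> B \<Longrightarrow> \<psi> (chart_inv c w) = a"
      unfolding constant_on_def by blast
    have "\<psi> q = a" if q: "q \<in> N - S" for q
    proof -
      have "snd c q \<notin> snd c ` (S \<inter> fst c)"
        using q inj_on_image_mem_iff[OF is_chartD(4)[OF ch], of q "S \<inter> fst c"] by (simp add: N_def)
      then have "snd c q \<in> B" using q by (simp add: N_def B_def)
      moreover have "chart_inv c (snd c q) = q" using q is_chartD(3)[OF ch] by (simp add: N_def)
      ultimately show ?thesis using a[of "snd c q"] by simp
    qed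
    moreover have "p \<in> N" using c e unfolding N_def by simp
    ultimately show ?thesis using \<open>open N\<close> by (intro exI[of _ N] exI[of _ a]) simp
  qed
  \<comment> \<open>\<open>G a\<close> is the largest open set on which the value off
    \<open>S\<close> is \<open>a\<close>. It may contain points of \<open>S\<close>, whatever the
    values there, so the sets \<open>G a\<close> cover the base. A nonempty overlap of two of them
    would contain a regular point with two values; connectedness then leaves a single one.\<close>
  define G where "G a = \<Union>{N. open N \<and> (\<forall>q\<in>N - S. \<psi> q = a)}" for a
  have oG: "open (G a)" for a unfolding G_def by auto
  have val: "\<psi> q = a" if "q \<in> G a" "q \<notin> S" for q a using that unfolding G_def by blast
  have disj: "G a \<inter> G b = {}" if "a \<noteq> b" for a b
  proof (rule ccontr)
    assume "G a \<inter> G b \<noteq> {}"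
    then have "G a \<inter> G b - S \<noteq> {}"
      using open_minus_finite_nonempty[OF A open_Int[OF oG oG] _ S] by blast
    then show False using val that by blast
  qed
  have cov: "\<exists>a. p \<in> G a" for p using loc[of p] unfolding G_def by blast
  obtain a where a: "G a \<noteq> {}" using cov by blast
  have "open (\<Union>b\<in>-{a}. G b)" using oG by blast
  moreover have "G a \<inter> (\<Union>b\<in>-{a}. G b) \<inter> UNIV = {}" using disj by blast
  moreover have "UNIV \<subseteq> G a \<union> (\<Union>b\<in>-{a}. G b)" using cov by blast
  ultimately have "G a \<inter> UNIV = {} \<or> (\<Union>b\<in>-{a}. G b) \<inter> UNIV = {}"
    using connectedD[OF K oG[of a]] by blast
  then have "p \<in> G a" for p using a cov[of p] by blast
  then show ?thesis using val by blast
qed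

section \<open>Kaluza--Klein modes\<close>

lemma compact_baseD:
  fixes \<A> :: "'b::t2_space chart set"
  assumes "compact_base \<A> S \<rho>"
  shows "compact (UNIV :: 'b set)" "connected (UNIV :: 'b set)" "holomorphic_atlas \<A>" "finite S"
    "surface_integrable \<A> (\<lambda>c w. exp (\<rho> c w))"
proof -
  note b = assms[unfolded compact_base_def]
  show "compact (UNIV :: 'b set)" using b by (elim conjE)
  show "connected (UNIV :: 'b set)" using b by (elim conjE)
  show "holomorphic_atlas \<A>" using b by (elim conjE)
  show "finite S" using b by (elim conjE)
  show "surface_integrable \<A> (\<lambda>c w. exp (\<rho> c w))" using b by (elim conjE)
qed

lemma surface_integrable_cmult:
  "surface_integrable \<A> d \<Longrightarrow> surface_integrable \<A> (\<lambda>c w. a * d c w)"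
  unfolding surface_integrable_def by (auto intro!: set_integrable_mult_right)

text \<open>Adding \<open>ln s\<close> multiplies the metric by \<open>s\<close>. The transition law
  is homogeneous in the metric, so \<open>s\<close> cancels there, and the area is multiplied by
  \<open>s\<close>.\<close>

lemma compact_base_rescale:
  assumes B: "compact_base \<A> S \<rho>" and s: "s > 0"
  shows "compact_base \<A> S (\<lambda>c w. ln s + \<rho> c w)"
proof -
  have e: "exp (ln s + x) = s * exp x" for x using s by (simp add: exp_add)
  have trans: "s * a = s * b * d \<longleftrightarrow> a = b * d" for a b d using s by simp
  have smooth: "\<forall>c\<in>\<A>. \<forall>k. Ck_on k (regular_range S c) (\<rho> c)"
    using B unfolding compact_base_def by (elim conjE)
  note base = compact_baseD[OF B]
  show ?thesis
    unfolding compact_base_def e trans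
  proof (intro conjI base(1-4) surface_integrable_cmult[OF base(5)])
    show "\<forall>c\<in>\<A>. \<forall>k. Ck_on k (regular_range S c) (\<lambda>w. ln s + \<rho> c w)"
      using smooth by (blast intro: Ck_on_add_const)
    show "\<forall>c\<in>\<A>. \<forall>c'\<in>\<A>. \<forall>p\<in>fst c \<inter> fst c' - S.
        exp (\<rho> c (snd c p)) =
        exp (\<rho> c' (snd c' p)) * (cmod (deriv (snd c' \<circ> chart_inv c) (snd c p)))\<^sup>2"
      using B unfolding compact_base_def by (elim conjE)
  qed
qed

lemma surface_integral_zero [simp]: "surface_integral \<A> (\<lambda>c w. 0) = 0"
  by (simp add: surface_integral_def set_lebesgue_integral_def)

text \<open>The constant has zero Dirichlet pairing with every test function, so only
  \<open>\<mu>\<close> remains as eigenvalue. Finite area is exactly the finiteness of its norm. In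
  the field equation the base derivatives drop out and the equation of \<open>\<phi>\<close>
  remains.\<close>

lemma KK_mode_constant:
  fixes \<A> :: "'b::t2_space chart set"
  assumes B: "compact_base \<A> S \<rho>"
  shows "KK_mode \<mu> \<A> S \<rho> (\<lambda>p. 1) \<mu>"
proof -
  note base = compact_baseD[OF B]
  have "rloc c (\<lambda>p. a) = (\<lambda>w. of_real a)" for c :: "'b chart" and a
    by (simp add: rloc_def fun_eq_iff)
  note const = this this[of _ 1, simplified]
  have "(\<lambda>p. 1) \<in> form_domain \<A> S \<rho>"
    using base(5) by (auto simp: form_domain_def const Ck_on_const surface_integrable_def set_integrable_def
        simp del: Ck_on.simps)
  \<comment> \<open>An eigenfunction must be nonzero at some regular point, so one has to
    exist.\<close>
  moreover have "\<exists>p. p \<notin> S"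
    using open_minus_finite_nonempty[OF base(3) open_UNIV _ base(4)] by blast
  moreover have "dirichlet_form \<A> (\<lambda>p. 1) \<eta> = 0" for \<eta>
    by (simp add: dirichlet_form_def const)
  ultimately have "form_eigenfunction \<mu> \<A> S \<rho> (\<lambda>p. 1) \<mu>"
    by (simp add: form_eigenfunction_def)
  moreover have eq: "decoupled_equation_at \<mu> \<rho> (\<lambda>x p. \<phi> x * 1) c x w"
    if "dalembertian \<phi> x - \<mu> * \<phi> x = 0" for \<phi> c x w
  proof -
    have "dalembertian \<phi> x = \<mu> * \<phi> x" using that by simp
    then show ?thesis by (simp add: decoupled_equation_at_def const)
  qed
  ultimately show ?thesis
    unfolding KK_mode_def by (intro conjI ballI allI impI Ck_on_const eq) (elim conjE, erule spec)
qed

section \<open>Definiteness of the norm and of the Dirichlet form\<close>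

lemma form_domainD:
  assumes "\<psi> \<in> form_domain \<A> S \<rho>" "c \<in> \<A>"
  shows "\<And>w. w \<in> regular_range S c \<Longrightarrow> (\<lambda>w. \<psi> (chart_inv c w)) differentiable (at w)"
    and "continuous_on (regular_range S c) (\<lambda>w. \<psi> (chart_inv c w))"
    and "continuous_on (regular_range S c) (d_z (rloc c \<psi>))"
proof -
  have C: "Ck_on 1 (regular_range S c) (\<lambda>w. \<psi> (chart_inv c w))"
    using assms by (simp add: form_domain_def del: Ck_on.simps)
  show d: "(\<lambda>w. \<psi> (chart_inv c w)) differentiable (at w)" if "w \<in> regular_range S c" for w
    using C that by simp
  show "continuous_on (regular_range S c) (\<lambda>w. \<psi> (chart_inv c w))"
    using d by (meson continuous_at_imp_continuous_on differentiable_imp_continuous_within)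
  have "continuous_on (regular_range S c) (\<lambda>w. frechet_derivative (\<lambda>w. \<psi> (chart_inv c w)) (at w) v)" for v
    using C by simp
  then have "continuous_on (regular_range S c) (\<lambda>w.
      (of_real (frechet_derivative (\<lambda>w. \<psi> (chart_inv c w)) (at w) 1) -
       \<i> * of_real (frechet_derivative (\<lambda>w. \<psi> (chart_inv c w)) (at w) \<i>)) / 2)"
    by (intro continuous_intros) auto
  then show "continuous_on (regular_range S c) (d_z (rloc c \<psi>))"
    using continuous_on_cong[of "regular_range S c" "regular_range S c" "d_z (rloc c \<psi>)"] d
    by (simp add: rloc_def[abs_def] d_z_of_real)
qed

lemma L2_norm_pos:
  fixes \<A> :: "'b::t2_space chart set"
  assumes B: "compact_base \<A> S \<rho>" and \<psi>: "\<psi> \<in> form_domain \<A> S \<rho>" and p: "p \<notin> S" "\<psi> p \<noteq> 0"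
  shows "L2_inner \<A> \<rho> \<psi> \<psi> > 0"
  unfolding L2_inner_def
proof (rule surface_integral_pos)
  note base = compact_baseD[OF B]
  note ch = holomorphic_atlasD(1)[OF base(3)]
  \<comment> \<open>This is the set of regular points where \<open>\<psi>\<close> is nonzero,
    written through coordinates because continuity is known there.\<close>
  let ?V = "\<Union>c\<in>\<A>. {p \<in> fst c - S. \<psi> (chart_inv c (snd c p)) \<noteq> 0}"
  show "holomorphic_atlas \<A>" "compact (UNIV :: 'b set)" using base by auto
  show "surface_integrable \<A> (\<lambda>c w. exp (\<rho> c w) * (\<psi> (chart_inv c w) * \<psi> (chart_inv c w)))"
    using \<psi> by (simp add: form_domain_def power2_eq_square)
  show "open ?V"
    using open_regular_nonzero[OF ch base(4) form_domainD(2)[OF \<psi>]] by (intro open_UN) blast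
  obtain c where c: "c \<in> \<A>" "p \<in> fst c" using holomorphic_atlasD(2)[OF base(3)] by blast
  then have "p \<in> {p \<in> fst c - S. \<psi> (chart_inv c (snd c p)) \<noteq> 0}"
    using p is_chartD(3)[OF ch[OF c(1)]] by simp
  then show "?V \<noteq> {}" using c(1) by blast
  show "exp (\<rho> c (snd c q)) * (\<psi> (chart_inv c (snd c q)) * \<psi> (chart_inv c (snd c q))) \<noteq> 0"
    if c: "c \<in> \<A>" and q: "q \<in> ?V" "q \<in> fst c" for c q
  proof -
    obtain c' where c': "c' \<in> \<A>" "q \<in> fst c'" "\<psi> (chart_inv c' (snd c' q)) \<noteq> 0"
      using q(1) by blast
    then have "\<psi> q \<noteq> 0" using is_chartD(3)[OF ch[OF c'(1)]] by simp
    then show ?thesis using is_chartD(3)[OF ch[OF c] q(2)] by simp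
  qed
qed simp

lemma dirichlet_form_self:
  "dirichlet_form \<A> \<psi> \<psi> = surface_integral \<A> (\<lambda>c w. 4 * (cmod (d_z (rloc c \<psi>) w))\<^sup>2)"
proof -
  have "4 * Re (z * cnj z) = 4 * (cmod z)\<^sup>2" for z
    unfolding cmod_power2 by (simp add: power2_eq_square)
  then show ?thesis by (simp only: dirichlet_form_def)
qed

lemma dirichlet_form_zero_constant:
  fixes \<A> :: "'b::t2_space chart set"
  assumes B: "compact_base \<A> S \<rho>" and \<psi>: "\<psi> \<in> form_domain \<A> S \<rho>"
    and z: "dirichlet_form \<A> \<psi> \<psi> = 0"
  shows "\<exists>a. \<forall>p. p \<notin> S \<longrightarrow> \<psi> p = a"
proof -
  note base = compact_baseD[OF B]
  note ch = holomorphic_atlasD(1)[OF base(3)]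
  have reg: "snd c p \<in> regular_range S c" if "p \<in> fst c - S" for c p
    using that unfolding regular_range_def by blast
  have iff: "d_z (rloc c \<psi>) (snd c p) = 0 \<longleftrightarrow>
      ((\<lambda>w. \<psi> (chart_inv c w)) has_derivative (\<lambda>_. 0)) (at (snd c p))"
    if c: "c \<in> \<A>" and p: "p \<in> fst c - S" for c p
  proof -
    note d = form_domainD(1)[OF \<psi> c reg[OF p]]
    show ?thesis
      unfolding rloc_def[abs_def] d_z_of_real_eq_0_iff[OF d]
      using has_derivative_frechet[OF d] frechet_derivative_eqI by metis
  qed
  define V where "V = (\<Union>c\<in>\<A>. {p \<in> fst c - S. d_z (rloc c \<psi>) (snd c p) \<noteq> 0})"
  have "V = {}"
  proof (rule ccontr)
    assume ne: "V \<noteq> {}"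
    have "surface_integral \<A> (\<lambda>c w. 4 * (cmod (d_z (rloc c \<psi>) w))\<^sup>2) > 0"
    proof (rule surface_integral_pos[OF base(3,1) _ _ _ ne])
      show "surface_integrable \<A> (\<lambda>c w. 4 * (cmod (d_z (rloc c \<psi>) w))\<^sup>2)"
        using \<psi> by (simp add: form_domain_def)
      show "open V"
        unfolding V_def using open_regular_nonzero[OF ch base(4) form_domainD(3)[OF \<psi>]]
        by (intro open_UN) blast
      show "4 * (cmod (d_z (rloc c \<psi>) (snd c q)))\<^sup>2 \<noteq> 0"
        if c: "c \<in> \<A>" and q: "q \<in> V" "q \<in> fst c" for c q
      proof
        assume "4 * (cmod (d_z (rloc c \<psi>) (snd c q)))\<^sup>2 = 0"
        then have 0: "d_z (rloc c \<psi>) (snd c q) = 0" by simp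
        \<comment> \<open>Membership in \<open>V\<close> is witnessed by some chart
          \<open>c'\<close>, while the density is tested in \<open>c\<close>; the transfer of
          vanishing derivatives bridges the two.\<close>
        obtain c' where c': "c' \<in> \<A>" "q \<in> fst c' - S" "d_z (rloc c' \<psi>) (snd c' q) \<noteq> 0"
          using q(1) unfolding V_def by blast
        have qc: "q \<in> fst c - S" "q \<in> fst c'" using c' q by auto
        show False
          using chart_derivative_zero_transfer[OF base(3) c c'(1) q(2) qc(2)] 0 c'(3)
          unfolding iff[OF c qc(1)] iff[OF c'(1,2)] by blast
      qed
    qed simp
    with z show False by (simp add: dirichlet_form_self)
  qed
  then have "d_z (rloc c \<psi>) (snd c p) = 0" if "c \<in> \<A>" "p \<in> fst c - S" for c p
    using that unfolding V_def by blast
  then show ?thesis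
    by (intro constant_off_finite[OF base(3,2,4)]) (simp add: iff[symmetric])
qed

text \<open>An eigenfunction lies in \<open>form_domain\<close> and so is an admissible test
  function. Since its norm is positive, the sign of the Dirichlet form is the sign of
  \<open>Msq - \<mu>\<close>, and equality puts the mode in the kernel of the form.\<close>

lemma constant_lowest_KK_mode:
  fixes \<A> :: "'b::t2_space chart set"
  assumes B: "compact_base \<A> S \<rho>"
  shows "lowest_KK_mode \<mu> \<A> S \<rho> (\<lambda>p. 1) \<mu>"
  unfolding lowest_KK_mode_def
proof (intro conjI allI impI)
  show "KK_mode \<mu> \<A> S \<rho> (\<lambda>p. 1) \<mu>" by (rule KK_mode_constant[OF B])
  fix \<psi> Msq assume "KK_mode \<mu> \<A> S \<rho> \<psi> Msq"
  then have "form_eigenfunction \<mu> \<A> S \<rho> \<psi> Msq" by (simp add: KK_mode_def)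
  then obtain p where \<psi>: "\<psi> \<in> form_domain \<A> S \<rho>" and p: "p \<notin> S" "\<psi> p \<noteq> 0"
    and "dirichlet_form \<A> \<psi> \<psi> + \<mu> * L2_inner \<A> \<rho> \<psi> \<psi> = Msq * L2_inner \<A> \<rho> \<psi> \<psi>"
    unfolding form_eigenfunction_def by blast
  then have eq: "dirichlet_form \<A> \<psi> \<psi> = (Msq - \<mu>) * L2_inner \<A> \<rho> \<psi> \<psi>"
    by (simp add: algebra_simps)
  have "dirichlet_form \<A> \<psi> \<psi> \<ge> 0"
    unfolding dirichlet_form_self by (rule surface_integral_nonneg) simp
  then show "\<mu> \<le> Msq"
    using L2_norm_pos[OF B \<psi> p] by (simp add: eq zero_le_mult_iff)
  assume "Msq = \<mu>"
  then show "\<exists>a. \<forall>p. p \<notin> S \<longrightarrow> \<psi> p = a * 1"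
    using dirichlet_form_zero_constant[OF B \<psi>] eq by simp
qed

section \<open>The constant background\<close>

lemma T_equation_constant_background:
  assumes "Im t = \<tau>\<^sub>2"
  shows "T_equation_at \<alpha> \<rho> (\<lambda>p. t) T C c x w \<longleftrightarrow>
    decoupled_equation_at (- (2 / \<alpha>) * \<tau>\<^sub>2 powr (-1/2)) \<rho> T c x w"
proof -
  have "loc c (\<lambda>p. a) = (\<lambda>w. a)" for a by (simp add: loc_def fun_eq_iff)
  then show ?thesis
    by (simp add: T_equation_at_def decoupled_equation_at_def m_eff_sq_def tau2_def assms)
qed

text \<open>The factors \<open>(Im t)\<^sup>2\<close> and \<open>1 / (Im t)\<^sup>2\<close> cancel,
  and the two second-order terms, equal by commutation, turn the coefficient 2 into 4.\<close>

lemma C_equation_constant_background: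
  fixes \<A> :: "'b::t2_space chart set"
  assumes B: "compact_base \<A> S \<rho>" and C: "fluctuation \<A> S C" and t: "Im t \<noteq> 0"
    and c: "c \<in> \<A>" and w: "w \<in> regular_range S c"
  shows "C_equation_at \<rho> (\<lambda>p. t) T C c x w \<longleftrightarrow> decoupled_equation_at 0 \<rho> C c x w"
proof -
  note base = compact_baseD[OF B]
  note R = regular_range_open[OF holomorphic_atlasD(1)[OF base(3) c] base(4)]
  have "Ck_on 2 (UNIV \<times> regular_range S c) (\<lambda>(x, w). C x (chart_inv c w))"
    using C c unfolding fluctuation_def by blast
  from Ck_on_slice[OF R this, of x]
  have g: "Ck_on 2 (regular_range S c) (\<lambda>w. C x (chart_inv c w))" by simp
  have loc: "loc c (\<lambda>p. a) = (\<lambda>w. a)" for a by (simp add: loc_def fun_eq_iff)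
  have rloc: "rloc c (C x) = (\<lambda>w. of_real (C x (chart_inv c w)))" by (simp add: rloc_def fun_eq_iff)
  let ?G = "rloc c (C x)" and ?k = "complex_of_real (1 / (Im t)\<^sup>2)"
  \<comment> \<open>Pulling the constant out of \<open>d_z\<close> and \<open>d_zbar\<close>
    requires differentiability, since \<open>frechet_derivative\<close> is an unspecified choice
    elsewhere. This is where second-order regularity of the field enters.\<close>
  have diff: "d_z ?G differentiable (at w)" "d_zbar ?G differentiable (at w)"
    unfolding rloc using has_derivative_d_z_of_real[OF R g w] by (auto simp: differentiable_def)
  have "d_z (\<lambda>v. ?k * d_zbar ?G v) w + d_zbar (\<lambda>v. ?k * d_z ?G v) w = 2 * ?k * d_z (d_zbar ?G) w"
    using d_z_d_zbar_commute[OF R g w, folded rloc]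
    unfolding d_z_cmult(1)[OF diff(2)] d_z_cmult(2)[OF diff(1)] by (simp only: mult_2 distrib_right)
  then have eq: "2 * of_real (exp (- \<rho> c w) * (Im t)\<^sup>2) *
      (d_z (\<lambda>v. ?k * d_zbar ?G v) w + d_zbar (\<lambda>v. ?k * d_z ?G v) w) =
      4 * of_real (exp (- \<rho> c w)) * d_z (d_zbar ?G) w"
    using t by simp
  then show ?thesis
    unfolding C_equation_at_def decoupled_equation_at_def tau2_def loc eq by simp
qed

theorem mainTheorem6:
  fixes \<alpha> :: real
    and \<A> :: "'b::t2_space chart set"
    and S :: "'b set"
    and \<rho> :: "'b chart \<Rightarrow> complex \<Rightarrow> real"
    and \<tau> :: "'b \<Rightarrow> complex"
    and \<tau>\<^sub>2 :: real
  assumes "\<alpha> > 0"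
    and "compact_base \<A> S \<rho>"
    and "\<tau> = (\<lambda>p. (1 + \<i>) / 2)"
    and "\<tau>\<^sub>2 = 1 / 2"
  shows "(\<forall>T C. fluctuation \<A> S T \<and> fluctuation \<A> S C \<longrightarrow>
           (\<forall>c\<in>\<A>. \<forall>x. \<forall>w\<in>regular_range S c.
              (T_equation_at \<alpha> \<rho> \<tau> T C c x w \<longleftrightarrow>
                 decoupled_equation_at (- (2 / \<alpha>) * \<tau>\<^sub>2 powr (-1/2)) \<rho> T c x w) \<and>
              (C_equation_at \<rho> \<tau> T C c x w \<longleftrightarrow> decoupled_equation_at 0 \<rho> C c x w)))
       \<and> lowest_KK_mode (- (2 / \<alpha>) * \<tau>\<^sub>2 powr (-1/2)) \<A> S \<rho> (\<lambda>p. 1)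
           (- 2 / (\<alpha> * sqrt \<tau>\<^sub>2))
       \<and> - 2 / (\<alpha> * sqrt \<tau>\<^sub>2) < 0
       \<and> (\<forall>s>0. lowest_KK_mode (- (2 / \<alpha>) * \<tau>\<^sub>2 powr (-1/2)) \<A> S (\<lambda>c w. ln s + \<rho> c w) (\<lambda>p. 1)
             (- 2 / (\<alpha> * sqrt \<tau>\<^sub>2)))"
proof (intro conjI allI impI ballI)
  have mass: "- (2 / \<alpha>) * \<tau>\<^sub>2 powr (-1/2) = - 2 / (\<alpha> * sqrt \<tau>\<^sub>2)"
    using assms(4) by (simp add: powr_minus powr_half_sqrt field_simps)
  \<comment> \<open>The metric is left arbitrary so that the given one and all its rescalings are
    instances; the mass involves only \<open>\<alpha>\<close> and
    \<open>\<tau>\<^sub>2\<close>.\<close>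
  have lowest: "lowest_KK_mode (- (2 / \<alpha>) * \<tau>\<^sub>2 powr (-1/2)) \<A> S \<rho>' (\<lambda>p. 1)
      (- 2 / (\<alpha> * sqrt \<tau>\<^sub>2))" if "compact_base \<A> S \<rho>'" for \<rho>'
    unfolding mass by (rule constant_lowest_KK_mode[OF that])
  show "lowest_KK_mode (- (2 / \<alpha>) * \<tau>\<^sub>2 powr (-1/2)) \<A> S \<rho> (\<lambda>p. 1)
      (- 2 / (\<alpha> * sqrt \<tau>\<^sub>2))"
    by (rule lowest[OF assms(2)])
  show "lowest_KK_mode (- (2 / \<alpha>) * \<tau>\<^sub>2 powr (-1/2)) \<A> S (\<lambda>c w. ln s + \<rho> c w) (\<lambda>p. 1)
      (- 2 / (\<alpha> * sqrt \<tau>\<^sub>2))" if "s > 0" for s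
    by (rule lowest[OF compact_base_rescale[OF assms(2) that]])
  show "- 2 / (\<alpha> * sqrt \<tau>\<^sub>2) < 0"
    using assms(1,4) by (simp add: divide_neg_pos)
  have im: "Im ((1 + \<i>) / 2) = \<tau>\<^sub>2" using assms(4) by simp
  fix T C :: "real ^ 8 \<Rightarrow> 'b \<Rightarrow> real" and c x w
  assume *: "fluctuation \<A> S T \<and> fluctuation \<A> S C" "c \<in> \<A>" "w \<in> regular_range S c"
  show "T_equation_at \<alpha> \<rho> \<tau> T C c x w \<longleftrightarrow>
      decoupled_equation_at (- (2 / \<alpha>) * \<tau>\<^sub>2 powr (-1/2)) \<rho> T c x w"
    unfolding assms(3) by (rule T_equation_constant_background[OF im])
  show "C_equation_at \<rho> \<tau> T C c x w \<longleftrightarrow> decoupled_equation_at 0 \<rho> C c x w"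
    unfolding assms(3)
    by (rule C_equation_constant_background[OF assms(2) conjunct2[OF *(1)] _ *(2,3)]) simp
qed

end
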